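(* Consider the partitioned optimization framework for the problem $(\mathrm{P}_{\mathrm{ini}})$: minimize $\varphi(y)$ over $y\in\mathbb{Y}$ subject to $y\in\Omega$, with partition $\mathbb{Y}=\bigsqcup_{x\in\mathbb{X}}\mathbb{Y}(x)$, set $X$ of effective partition indices, oracle function $\gamma:X\to Y$, index function $\chi:\mathbb{Y}\to\mathbb{X}$, and reformulated problem $(\mathrm{P}_{\mathrm{ref}})$: minimize $\Phi(x)$ over $x\in\mathbb{X}$ (all as defined in the context). Assume: (1) $\chi$ is continuous, and $X$ admits a partition $X=\bigsqcup_{i=1}^N X_i$, with $N\in\{1,2,\dots\}\cup\{+\infty\}$, such that for every $x\in\mathrm{cl}(X)$ there is a neighbourhood $\mathcal{X}\subseteq\mathbb{X}$ of $x$ for which $\{i: 1\le i\le N,\ X_i\cap\mathcal{X}\neq\emptyset\}$ is finite, and such that $\gamma_{|X_i}$ is uniformly continuous for every $i$; (2) $\chi(\mathcal{Y})$ is bounded for every bounded $\mathcal{Y}\subseteq\mathbb{Y}$; $\varphi_{|\gamma(X)}$ is bounded below and has bounded sublevel sets; and, for every $i$, the set $X_i$ is ample and $\varphi_{|\gamma(X_i)}$ is continuous. Then the covering algorithm framework described in the context, applied to $(\mathrm{P}_{\mathrm{ref}})$, generates a sequence $(x^k)_{k\in\mathbb{N}}$ such that $\mathrm{acc}((x^k)_{k\in\mathbb{N}})\neq\emptyset$ and, for every $x^*\in\mathrm{acc}((x^k)_{k\in\mathbb{N}})$, the set $\mathcal{ACC}(\gamma;x^* )$ contains a generalized local solution to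 $(\mathrm{P}_{\mathrm{ini}})$. Moreover, for every $x^*\in\mathrm{acc}((x^k)_{k\in\mathbb{N}})$, if $x^*\in X$ and $\varphi$ is lower semicontinuous at every $y\in\mathcal{ACC}(\gamma;x^* )$ and $\mathcal{ACC}(\gamma;x^* )\subseteq\Omega$, then $\gamma(x^* )$ is a local solution to $(\mathrm{P}_{\mathrm{ini}})$.
   Context: Notation. $\overline{\mathbb{R}}=\mathbb{R}\cup\{\pm\infty\}$; $\mathrm{cl}$ and $\mathrm{int}$ are closure and interior. A subset $A$ of a normed space is ample if $A\subseteq\mathrm{cl}(\mathrm{int}(A))$. For a sequence $(b^k)_{k\in\mathbb{N}}$, $\mathrm{acc}((b^k)_{k\in\mathbb{N}})$ is the set of all its accumulation points (in $\overline{\mathbb{R}}$ for extended-real sequences). For a function $g$ defined on a subset $D$ of a normed space and a point $a$ of the space, $\mathcal{ACC}(g;a)$ is the union of $\mathrm{acc}((g(a^k))_{k\in\mathbb{N}})$ over all sequences $(a^k)_{k\in\mathbb{N}}\in D^{\mathbb{N}}$ converging to $a$. For $f:\mathbb{A}\to\overline{\mathbb{R}}$ and $A\subseteq\mathbb{A}$, the extreme barrier function $\overline{f}_A:\mathbb{A}\to\overline{\mathbb{R}}$ is $\overline{f}_A(a)=f(a)$ if $a\in A$ and $+\infty$ otherwise. When $N=+\infty$, the index $i$ ranges over all positive integers. Initial problem $(\mathrm{P}_{\mathrm{ini}})$. $\mathbb{Y}$ is a (possibly infinite-dimensional) Banach space, $\Omega\subseteq\mathbb{Y}$, and $\varphi:\mathbb{Y}\to\overline{\mathbb{R}}$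 (possibly discontinuous) has effective domain $Y=\{y\in\mathbb{Y}:\varphi(y)\neq\pm\infty\}$ with $Y\cap\Omega\neq\emptyset$. The problem is to minimize $\varphi(y)$ over $y\in\mathbb{Y}$ subject to $y\in\Omega$. Partitioned optimization framework. $\mathbb{X}$ is a finite-dimensional normed space and $\mathbb{Y}=\bigsqcup_{x\in\mathbb{X}}\mathbb{Y}(x)$ is a partition (pairwise disjoint sets indexed by $\mathbb{X}$ with union $\mathbb{Y}$). The set of effective partition indices is $X=\{x\in\mathbb{X}:\mathbb{Y}(x)\cap Y\cap\Omega\neq\emptyset\}$. It is assumed that, for every $x\in X$, the subproblem of minimizing $\varphi(y)$ over $y\in\mathbb{Y}(x)$ subject to $y\in\Omega$ admits a nonempty set $\Gamma(x)\subseteq\mathbb{Y}(x)$ of global solutions. The oracle function $\gamma:X\to Y$ satisfies $\gamma(x)\in\Gamma(x)$ for every $x\in X$. The index function $\chi:\mathbb{Y}\to\mathbb{X}$ maps $y$ to the unique $x\in\mathbb{X}$ with $y\in\mathbb{Y}(x)$. The reformulated problem $(\mathrm{P}_{\mathrm{ref}})$ is to minimize $\Phi(x)$ over $x\in\mathbb{X}$ (no constraint), where $\Phi:\mathbb{X}\to\overline{\mathbb{R}}$ is $\Phi(x)=\varphi(\gamma(x))$ if $x\in X$ and $\Phi(x)=+\infty$ otherwise. Generalized local solution. For a normed space $\mathbb{A}$, $A\subseteq\mathbb{A}$ and $f:\mathbb{A}\to\overline{\mathbb{R}}$, a point $a^*\in\mathrm{cl}(A)$ is a generalized local solution to the problem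 of minimizing $f(a)$ over $a\in\mathbb{A}$ subject to $a\in A$ if there is a neighbourhood $\mathcal{A}^*\subseteq\mathbb{A}$ of $a^*$ such that $\inf\overline{f}_A(\mathcal{A}^* )=\inf\mathcal{ACC}(\overline{f}_A;a^* )$. Local solutions have their usual meaning (feasible points minimizing the objective over the intersection of the feasible set with some neighbourhood of the point). Covering operator. For $x\in\mathbb{X}$ and $\mathcal{H}\subseteq\mathbb{X}$, $\mathrm{covering}(x,\mathcal{H})=\mathrm{argmax}_{\|d\|\le 1}\,\mathrm{dist}(x+d,\mathcal{H})$, where $\mathrm{dist}(x,\mathcal{H})=\inf_{h\in\mathcal{H}}\|x-h\|$ if $\mathcal{H}\neq\emptyset$ and $\mathrm{dist}(x,\emptyset)=+\infty$. Covering algorithm framework. For a set $T\subseteq\mathbb{X}$, "$t\in\mathrm{argmin}\,\Phi(T)$" means that $t\in T$ minimizes $\Phi$ over $T$. Initialization: select $x^0\in X$; set $\mathcal{H}^0=\{x^0\}$; select an arbitrary iterative optimization algorithm $\mathcal{A}$. For each $k\in\mathbb{N}$ (the algorithm runs forever): - Covering step: set $\mathcal{D}_C^k=\mathrm{covering}(x^k,\mathcal{H}^k)$ and $\mathcal{T}_C^k=\{x^k\}+\mathcal{D}_C^k$; select $t_C^k\in\mathrm{argmin}\,\Phi(\mathcal{T}_C^k)$. If $\Phi(t_C^k)<\Phi(x^k)$, set $t^k=t_C^k$ and $\mathcal{T}_A^k=\emptyset$ and go to the update step. - Core algorithm step: select a finite set $\mathcal{T}_A^k\subseteq\mathbb{X}$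 of trial points according to the iterative scheme of $\mathcal{A}$ (no property of $\mathcal{A}$ is assumed); select $t_A^k\in\mathrm{argmin}\,\Phi(\mathcal{T}_A^k)$; if $\Phi(t_A^k)<\Phi(x^k)$ set $t^k=t_A^k$, otherwise set $t^k=x^k$. - Update step: set $x^{k+1}=t^k$ and $\mathcal{H}^{k+1}=\mathcal{H}^k\cup\mathcal{T}_C^k\cup\mathcal{T}_A^k$. The claim concerns any sequence $(x^k)_{k\in\mathbb{N}}$ generated in this way. *)

theory Defs
  imports "HOL-Analysis.Analysis"
begin

(* "U is a neighbourhood of a" is written  a \<in> interior U ; a neighbourhood need not be open. *)

definition ample :: "'a::real_normed_vector set \<Rightarrow> bool" where
  "ample A \<longleftrightarrow> A \<subseteq> closure (interior A)"

definition acc_points :: "(nat \<Rightarrow> 'a::topological_space) \<Rightarrow> 'a set" where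
  "acc_points b = {l. \<exists>r :: nat \<Rightarrow> nat. strict_mono r \<and> (b \<circ> r) \<longlonglongrightarrow> l}"

(* HOL functions are total, so the domain D of g is an explicit argument. *)
definition ACC_points :: "'a::real_normed_vector set \<Rightarrow> ('a \<Rightarrow> 'b::topological_space) \<Rightarrow> 'a \<Rightarrow> 'b set" where
  "ACC_points D g a = (\<Union>s \<in> {s :: nat \<Rightarrow> 'a. range s \<subseteq> D \<and> s \<longlonglongrightarrow> a}. acc_points (g \<circ> s))"

definition extreme_barrier :: "('a \<Rightarrow> ereal) \<Rightarrow> 'a set \<Rightarrow> 'a \<Rightarrow> ereal" where
  "extreme_barrier f A a = (if a \<in> A then f a else \<infinity>)"

definition effective_domain :: "('a \<Rightarrow> ereal) \<Rightarrow> 'a set" where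
  "effective_domain f = {a. f a \<noteq> \<infinity> \<and> f a \<noteq> -\<infinity>}"

definition global_solutions :: "('a \<Rightarrow> ereal) \<Rightarrow> 'a set \<Rightarrow> 'a set" where
  "global_solutions f A = {a. is_arg_min f (\<lambda>b. b \<in> A) a}"

definition local_solution :: "('a::real_normed_vector \<Rightarrow> ereal) \<Rightarrow> 'a set \<Rightarrow> 'a \<Rightarrow> bool" where
  "local_solution f A a \<longleftrightarrow>
     a \<in> A \<and> (\<exists>U. a \<in> interior U \<and> (\<forall>b \<in> A \<inter> U. f a \<le> f b))"

definition generalized_local_solution ::
    "('a::real_normed_vector \<Rightarrow> ereal) \<Rightarrow> 'a set \<Rightarrow> 'a \<Rightarrow> bool" where
  "generalized_local_solution f A a \<longleftrightarrow>
     a \<in> closure A \<and>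
     (\<exists>U. a \<in> interior U \<and>
          Inf (extreme_barrier f A ` U) = Inf (ACC_points UNIV (extreme_barrier f A) a))"

definition lsc_at :: "('a::topological_space \<Rightarrow> ereal) \<Rightarrow> 'a \<Rightarrow> bool" where
  "lsc_at f a \<longleftrightarrow> f a \<le> Liminf (at a) f"

(* A partition of the space 'y is a family  blk  of blocks indexed by the points of 'x. *)

definition effective_indices ::
    "('y \<Rightarrow> ereal) \<Rightarrow> 'y set \<Rightarrow> ('x \<Rightarrow> 'y set) \<Rightarrow> 'x set" where
  "effective_indices \<phi> \<Omega> blk = {x. blk x \<inter> effective_domain \<phi> \<inter> \<Omega> \<noteq> {}}"

definition index_fun :: "('x \<Rightarrow> 'y set) \<Rightarrow> 'y \<Rightarrow> 'x" where
  "index_fun blk y = (THE x. y \<in> blk x)"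

(* Only the values of \<gamma> on the effective indices are meaningful. *)
definition oracle_fun ::
    "('y \<Rightarrow> ereal) \<Rightarrow> 'y set \<Rightarrow> ('x \<Rightarrow> 'y set) \<Rightarrow> ('x \<Rightarrow> 'y) \<Rightarrow> bool" where
  "oracle_fun \<phi> \<Omega> blk \<gamma> \<longleftrightarrow>
     (\<forall>x \<in> effective_indices \<phi> \<Omega> blk.
        \<gamma> x \<in> effective_domain \<phi> \<and> \<gamma> x \<in> global_solutions \<phi> (blk x \<inter> \<Omega>))"

definition reformulated_objective ::
    "('y \<Rightarrow> ereal) \<Rightarrow> 'y set \<Rightarrow> ('x \<Rightarrow> 'y set) \<Rightarrow> ('x \<Rightarrow> 'y) \<Rightarrow> 'x \<Rightarrow> ereal" where
  "reformulated_objective \<phi> \<Omega> blk \<gamma> x =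
     (if x \<in> effective_indices \<phi> \<Omega> blk then \<phi> (\<gamma> x) else \<infinity>)"

(* Unlike the library's infdist, the distance to the empty set is +\<infinity>. *)
definition edist_set :: "'x::real_normed_vector \<Rightarrow> 'x set \<Rightarrow> ereal" where
  "edist_set x H = (INF h\<in>H. ereal (norm (x - h)))"

definition covering :: "'x::real_normed_vector \<Rightarrow> 'x set \<Rightarrow> 'x set" where
  "covering x H = {d. is_arg_max (\<lambda>d. edist_set (x + d) H) (\<lambda>d. norm d \<le> 1) d}"

(* One iteration from (x, H) to (x', H').  The core algorithm is unconstrained, so its
   trial set T_A is an arbitrary finite set; as t_A must be selected in it, it is nonempty. *)
definition covering_step ::
    "('x::real_normed_vector \<Rightarrow> ereal) \<Rightarrow> 'x \<Rightarrow> 'x set \<Rightarrow> 'x \<Rightarrow> 'x set \<Rightarrow> bool" where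
  "covering_step \<Phi> x H x' H' \<longleftrightarrow>
     (\<exists>T_C t_C T_A.
        T_C = (\<lambda>d. x + d) ` covering x H \<and>
        is_arg_min \<Phi> (\<lambda>t. t \<in> T_C) t_C \<and>
        (if \<Phi> t_C < \<Phi> x then x' = t_C \<and> T_A = {}
         else finite T_A \<and>
              (\<exists>t_A. is_arg_min \<Phi> (\<lambda>t. t \<in> T_A) t_A \<and>
                     x' = (if \<Phi> t_A < \<Phi> x then t_A else x))) \<and>
        H' = H \<union> T_C \<union> T_A)"

(* x is a sequence of iterates generated by the covering algorithm framework that minimizes
   \<Phi>, with starting point in X. *)
definition covering_algorithm_sequence ::
    "('x::real_normed_vector \<Rightarrow> ereal) \<Rightarrow> 'x set \<Rightarrow> (nat \<Rightarrow> 'x) \<Rightarrow> bool" where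
  "covering_algorithm_sequence \<Phi> X x \<longleftrightarrow>
     x 0 \<in> X \<and>
     (\<exists>H. H 0 = {x 0} \<and> (\<forall>k. covering_step \<Phi> (x k) (H k) (x (Suc k)) (H (Suc k))))"

end

theory Submission
  imports Defs
begin

text \<open>
  Along the iterates \<open>x k\<close> the values \<open>\<Phi> (x k)\<close> decrease to some \<open>L\<close>, and every trial point has value at
  least \<open>L\<close>. The iterates stay in a sublevel set, whose image under the index function is bounded, so
  they accumulate because the index space has finite dimension
  (\<open>bounded_seq_convergent_subseq_finite_span\<close>).

  Let \<open>xs\<close> be an accumulation point. Since trial points are chosen as far as possible from the earlier
  ones within unit distance of the iterate, and a bounded sequence cannot stay uniformly separated,
  the trial points are dense in the unit ball around \<open>xs\<close> (\<open>trial_points_dense_near_acc_point\<close>).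
  Ampleness of the pieces and continuity of \<open>\<Phi>\<close> on each of them turn this into \<open>\<Phi> \<ge> L\<close> on the entire
  ball (\<open>ample_continuous_ge_from_dense\<close>). As \<open>\<Phi>\<close> is the optimal value over a block,
  \<open>\<phi> \<ge> L\<close> holds at every feasible point that the index function sends into the ball, with the
  exception of feasible points where \<open>\<phi> = -\<infinity>\<close>, which may lie in blocks outside the effective indices.

  Near \<open>xs\<close> only finitely many pieces matter, so a subsequence of the iterates stays in one piece,
  and uniform continuity of the oracle there makes the oracle values converge to some
  \<open>ys\<close> (\<open>locally_finite_pieces_convergent_image\<close>). The index function sends \<open>ys\<close> to \<open>xs\<close>, and \<open>L\<close> is an
  accumulation value of the barrier function at \<open>ys\<close>. Either the value \<open>-\<infinity>\<close> is avoided at feasible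
  points near \<open>ys\<close>, and then both infima of the definition equal \<open>L\<close> for a small enough neighbourhood,
  or it is not, and then both equal \<open>-\<infinity>\<close>; so \<open>ys\<close> is a generalized local solution
  (\<open>generalized_local_solutionI\<close>).

  When \<open>xs\<close> is an effective index and the semicontinuity and feasibility hypotheses hold,
  \<open>\<phi> (\<gamma> xs) \<le> \<phi> ys \<le> L\<close> since \<open>ys\<close> is feasible and lies in the block of \<open>xs\<close>, and semicontinuity at
  \<open>\<gamma> xs\<close> excludes the value \<open>-\<infinity>\<close> nearby.
\<close>

section \<open>Compactness in finitely spanned normed spaces\<close>

text \<open>Induction on the spanning set. The induction hypothesis makes \<open>span B\<close> closed, so a new vector
  \<open>b\<close> has positive distance \<open>\<delta>\<close> from it; this bounds the \<open>b\<close>-coordinates of a bounded sequence.\<close>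

lemma bounded_seq_convergent_subseq_span:
  fixes B :: "'a::real_normed_vector set"
  assumes "finite B"
  shows "range v \<subseteq> span B \<Longrightarrow> bounded (range v) \<Longrightarrow>
    \<exists>l r. l \<in> span B \<and> strict_mono (r :: nat \<Rightarrow> nat) \<and> (v \<circ> r) \<longlonglongrightarrow> l"
  using assms
proof (induction B arbitrary: v rule: finite_induct)
  case empty
  then have "v \<circ> id = (\<lambda>n. 0)" by auto
  then have "(v \<circ> id) \<longlonglongrightarrow> 0" by simp
  moreover have "strict_mono (id :: nat \<Rightarrow> nat)" by (simp add: strict_mono_def)
  ultimately show ?case using span_zero by blast
next
  case (insert b B)
  show ?case
  proof (cases "b \<in> span B")
    case True
    then show ?thesis using insert.prems insert.IH[of v] by (simp add: span_redundant)
  next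
    case False
    have "closed (span B)"
      unfolding closed_sequential_limits
    proof (intro allI impI, elim conjE)
      fix w l assume w: "\<forall>n. w n \<in> span B" and wl: "w \<longlonglongrightarrow> l"
      have "bounded (range w)" using wl convergent_imp_bounded by blast
      then obtain l' r where l': "l' \<in> span B" "strict_mono (r :: nat \<Rightarrow> nat)" "(w \<circ> r) \<longlonglongrightarrow> l'"
        using insert.IH[of w] w by blast
      have "(w \<circ> r) \<longlonglongrightarrow> l" using wl l'(2) LIMSEQ_subseq_LIMSEQ by blast
      then show "l \<in> span B" using l' LIMSEQ_unique by blast
    qed
    then have "open (- span B)" by auto
    then obtain \<delta> where \<delta>: "\<delta> > 0" "ball b \<delta> \<subseteq> - span B"
      using False open_contains_ball[of "- span B"] by auto
    have far: "\<delta> \<le> norm (b - s)" if "s \<in> span B" for s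
      using \<delta>(2) that by (force simp: dist_norm)
    have "\<forall>n. \<exists>c. v n - c *\<^sub>R b \<in> span B"
      using insert.prems(1) span_breakdown_eq by blast
    then obtain c where c: "\<And>n. v n - c n *\<^sub>R b \<in> span B" by metis
    obtain M where M: "\<And>n. norm (v n) \<le> M"
      using insert.prems(2) by (auto simp: bounded_iff)
    have cb: "\<bar>c n\<bar> * \<delta> \<le> M" for n
    proof (cases "c n = 0")
      case True
      then show ?thesis using order_trans[OF norm_ge_zero M[of n]] by simp
    next
      case False
      \<comment> \<open>dividing \<open>v n = c n b + s\<close> by \<open>c n\<close> compares \<open>b\<close> with a point of the smaller span\<close>
      define s where "s = (- 1 / c n) *\<^sub>R (v n - c n *\<^sub>R b)"
      have "s \<in> span B" unfolding s_def using c span_scale by blast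
      moreover have "b - s = (1 / c n) *\<^sub>R v n"
        unfolding s_def using False by (simp add: algebra_simps)
      ultimately have "\<delta> \<le> norm (v n) / \<bar>c n\<bar>" using far[of s] by (simp add: divide_inverse mult.commute)
      then have "\<bar>c n\<bar> * \<delta> \<le> norm (v n)" using False by (simp add: field_simps)
      then show ?thesis using M[of n] by linarith
    qed
    then have "bounded (range c)"
      unfolding bounded_iff using \<delta>(1) by (auto simp: field_simps intro!: exI[of _ "M / \<delta>"])
    then obtain c0 r where r: "strict_mono (r :: nat \<Rightarrow> nat)" "(c \<circ> r) \<longlonglongrightarrow> c0"
      using bounded_imp_convergent_subsequence[of c] by blast
    define s where "s n = v (r n) - c (r n) *\<^sub>R b" for n
    have sM: "norm (s n) \<le> M + M / \<delta> * norm b" for n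
    proof -
      have "norm (s n) \<le> norm (v (r n)) + norm (c (r n) *\<^sub>R b)"
        unfolding s_def by (rule norm_triangle_ineq4)
      also have "\<dots> \<le> M + M / \<delta> * norm b"
        unfolding norm_scaleR using cb[of "r n"] \<delta>(1)
        by (intro add_mono M mult_right_mono norm_ge_zero) (simp add: field_simps)
      finally show ?thesis .
    qed
    have "range s \<subseteq> span B" using c by (auto simp: s_def)
    moreover have "bounded (range s)" using sM by (auto simp: bounded_iff)
    ultimately obtain s0 q where q: "s0 \<in> span B" "strict_mono (q :: nat \<Rightarrow> nat)" "(s \<circ> q) \<longlonglongrightarrow> s0"
      using insert.IH[of s] by blast
    have "(c \<circ> r \<circ> q) \<longlonglongrightarrow> c0" using r(2) q(2) LIMSEQ_subseq_LIMSEQ by blast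
    then have "(\<lambda>n. (c \<circ> r \<circ> q) n *\<^sub>R b + (s \<circ> q) n) \<longlonglongrightarrow> c0 *\<^sub>R b + s0"
      by (intro tendsto_intros q(3))
    moreover have "(\<lambda>n. (c \<circ> r \<circ> q) n *\<^sub>R b + (s \<circ> q) n) = v \<circ> (r \<circ> q)"
      by (auto simp: s_def)
    ultimately have "(v \<circ> (r \<circ> q)) \<longlonglongrightarrow> c0 *\<^sub>R b + s0" by simp
    moreover have "c0 *\<^sub>R b + s0 \<in> span (insert b B)"
      using q(1) by (auto simp: span_breakdown_eq intro!: exI[of _ c0])
    ultimately show ?thesis using strict_mono_o[OF r(1) q(2)] by blast
  qed
qed

lemma bounded_seq_convergent_subseq_finite_span:
  fixes v :: "nat \<Rightarrow> 'a::real_normed_vector"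
  assumes "\<exists>B :: 'a set. finite B \<and> span B = UNIV" and "bounded (range v)"
  shows "\<exists>l r. strict_mono (r :: nat \<Rightarrow> nat) \<and> (v \<circ> r) \<longlonglongrightarrow> l"
  using assms bounded_seq_convergent_subseq_span by (metis top_greatest)

section \<open>The covering algorithm\<close>

lemma covering_step_le:
  assumes "covering_step \<Phi> x H x' H'"
  shows "\<Phi> x' \<le> \<Phi> x"
  using assms unfolding covering_step_def by (auto simp: less_imp_le split: if_splits)

lemma covering_step_trial_ge:
  assumes "covering_step \<Phi> x H x' H'" and "h \<in> H'"
  shows "h \<in> H \<or> \<Phi> x' \<le> \<Phi> h"
  using assms unfolding covering_step_def is_arg_min_linorder
  by (fastforce split: if_splits)

lemma covering_step_farthest_point:
  assumes "covering_step \<Phi> x H x' H'"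
  obtains t where "t \<in> H'" "norm (t - x) \<le> 1"
    "\<And>z. norm (z - x) \<le> 1 \<Longrightarrow> edist_set z H \<le> edist_set t H"
proof -
  obtain d where d: "d \<in> covering x H" "x + d \<in> H'"
    using assms unfolding covering_step_def is_arg_min_def by fastforce
  have "edist_set z H \<le> edist_set (x + d) H" if "norm (z - x) \<le> 1" for z
    using d(1) that unfolding covering_def is_arg_max_linorder
    by (auto dest: spec[of _ "z - x"])
  then show thesis
    using that[of "x + d"] d by (auto simp: covering_def is_arg_max_def)
qed

lemma covering_step_mono: "covering_step \<Phi> x H x' H' \<Longrightarrow> H \<subseteq> H'"
  unfolding covering_step_def by blast

lemma covering_values_decseq:
  fixes \<Phi> :: "'a::real_normed_vector \<Rightarrow> ereal"
  assumes "\<And>k. covering_step \<Phi> (x k) (H k) (x (Suc k)) (H (Suc k))"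
  shows "decseq (\<lambda>k. \<Phi> (x k))"
  using assms covering_step_le by (blast intro: decseq_SucI)

lemma covering_history_ge:
  fixes \<Phi> :: "'a::real_normed_vector \<Rightarrow> ereal"
  assumes "H 0 = {x 0}"
    and step: "\<And>k. covering_step \<Phi> (x k) (H k) (x (Suc k)) (H (Suc k))"
    and "h \<in> H k"
  shows "\<Phi> (x k) \<le> \<Phi> h"
  using assms(3)
proof (induction k)
  case 0
  then show ?case using assms(1) by simp
next
  case (Suc k)
  then show ?case
    using covering_step_trial_ge[OF step] covering_step_le[OF step[of k]] order_trans by blast
qed

text \<open>For iterates converging to \<open>xs\<close>, the farthest points \<open>t\<close> chosen at each of them are bounded, so two
  of them are close. The earlier one already belongs to the set of trial points when the later one is
  chosen, and the latter is at least as far from that set as any point of the unit ball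
  around the iterate.\<close>

lemma trial_points_dense_near_acc_point:
  fixes x :: "nat \<Rightarrow> 'a::real_normed_vector"
  assumes fin: "\<exists>B :: 'a set. finite B \<and> span B = UNIV"
    and step: "\<And>k. covering_step \<Phi> (x k) (H k) (x (Suc k)) (H (Suc k))"
    and xs: "xs \<in> acc_points x"
  shows "ball xs 1 \<subseteq> closure (\<Union>k. H k)"
proof -
  have "mono H" using covering_step_mono[OF step] by (rule mono_iff_le_Suc[THEN iffD2, OF allI])
  obtain r where r: "strict_mono (r :: nat \<Rightarrow> nat)" "(x \<circ> r) \<longlonglongrightarrow> xs"
    using xs unfolding acc_points_def by blast
  have "\<forall>j. \<exists>t. t \<in> H (Suc (r j)) \<and> norm (t - x (r j)) \<le> 1 \<and>
      (\<forall>z. norm (z - x (r j)) \<le> 1 \<longrightarrow> edist_set z (H (r j)) \<le> edist_set t (H (r j)))"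
    using covering_step_farthest_point[OF step] by metis
  then obtain t where t: "\<And>j. t j \<in> H (Suc (r j))" "\<And>j. norm (t j - x (r j)) \<le> 1"
      "\<And>j z. norm (z - x (r j)) \<le> 1 \<Longrightarrow> edist_set z (H (r j)) \<le> edist_set (t j) (H (r j))"
    by metis
  have "bounded (range (x \<circ> r))" using r(2) convergent_imp_bounded by blast
  then obtain M where M: "\<And>j. norm (x (r j)) \<le> M" by (auto simp: bounded_iff)
  have "norm (t j) \<le> 1 + M" for j
    using norm_triangle_ineq[of "t j - x (r j)" "x (r j)"] t(2)[of j] M[of j] by simp
  then have "bounded (range t)" by (auto simp: bounded_iff)
  then obtain l s where s: "strict_mono (s :: nat \<Rightarrow> nat)" "(t \<circ> s) \<longlonglongrightarrow> l"
    using bounded_seq_convergent_subseq_finite_span[OF fin] by blast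
  have "z \<in> closure (\<Union>k. H k)" if z: "z \<in> ball xs 1" for z
    unfolding closure_approachable
  proof (intro allI impI)
    fix e :: real assume "e > 0"
    have "Cauchy (t \<circ> s)" using s(2) LIMSEQ_imp_Cauchy by blast
    then obtain n where n: "\<And>i j. i \<ge> n \<Longrightarrow> j \<ge> n \<Longrightarrow> dist (t (s i)) (t (s j)) < e"
      using \<open>e > 0\<close> unfolding Cauchy_def by (metis comp_apply)
    have "(x \<circ> r \<circ> s) \<longlonglongrightarrow> xs" using r(2) s(1) LIMSEQ_subseq_LIMSEQ by blast
    then have "\<forall>\<^sub>F j in sequentially. (x \<circ> r \<circ> s) j \<in> ball z 1"
      by (rule topological_tendstoD[OF _ open_ball]) (use z in \<open>simp add: dist_commute\<close>)
    then obtain m where m: "\<And>j. j \<ge> m \<Longrightarrow> x (r (s j)) \<in> ball z 1"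
      unfolding eventually_sequentially by auto
    define j where "j = Suc (max n m)"
    have "s n < s j" using s(1) by (simp add: j_def strict_mono_def)
    then have "Suc (r (s n)) \<le> r (s j)" using r(1) by (simp add: strict_mono_def Suc_leI)
    then have tn: "t (s n) \<in> H (r (s j))" using t(1) \<open>mono H\<close> by (meson monoD subsetD)
    have "m \<le> j" by (simp add: j_def)
    then have "norm (z - x (r (s j))) \<le> 1" using m[of j] by (simp add: dist_norm)
    then have "edist_set z (H (r (s j))) \<le> edist_set (t (s j)) (H (r (s j)))" by (rule t(3))
    also have "\<dots> \<le> ereal (norm (t (s j) - t (s n)))"
      unfolding edist_set_def using tn by (rule INF_lower)
    also have "\<dots> < ereal e" using n[of j n] by (simp add: j_def dist_norm)
    finally obtain h where "h \<in> H (r (s j))" "norm (z - h) < e"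
      unfolding edist_set_def by (auto simp: INF_less_iff)
    then show "\<exists>y\<in>\<Union>k. H k. dist y z < e" by (metis UN_I UNIV_I dist_norm norm_minus_commute)
  qed
  then show ?thesis by blast
qed

section \<open>Ample sets, semicontinuity and accumulation values\<close>

lemma ample_continuous_ge_from_dense:
  fixes f :: "'a::real_normed_vector \<Rightarrow> ereal"
  assumes "ample A" "continuous_on A f" "open U" "U \<subseteq> closure S"
    and ge: "\<And>h. h \<in> S \<Longrightarrow> L \<le> f h"
    and z: "z \<in> A" "z \<in> U"
  shows "L \<le> f z"
proof (rule ccontr)
  assume "\<not> L \<le> f z"
  then have "f z \<in> {..<L}" by simp
  obtain T where T: "open T" "T \<inter> A = f -` {..<L} \<inter> A"
    using assms(2) open_lessThan[of L] unfolding continuous_on_open_invariant by metis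
  have "z \<in> T" using T(2) z \<open>f z \<in> {..<L}\<close> by blast
  then have "T \<inter> U \<inter> interior A \<noteq> {}"
    using z assms(1,3) T(1) open_Int_closure_eq_empty[of "T \<inter> U" "interior A"]
    unfolding ample_def by blast
  moreover have "open (T \<inter> U \<inter> interior A)" using T(1) assms(3) by blast
  ultimately have "T \<inter> U \<inter> interior A \<inter> S \<noteq> {}"
    using assms(4) open_Int_closure_eq_empty[of "T \<inter> U \<inter> interior A" S] by blast
  then obtain h where "h \<in> T \<inter> A" "h \<in> S" using interior_subset[of A] by blast
  then show False using T(2) ge[of h] by auto
qed

lemma lsc_at_eventually_nhds:
  assumes "lsc_at f a" "c < f a"
  shows "\<forall>\<^sub>F b in nhds a. c < f b"
  using assms less_LiminfD[of c "at a" f]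
  unfolding lsc_at_def eventually_nhds_conv_at by (auto dest: less_le_trans)

lemma lsc_at_le_seq_limit:
  assumes "lsc_at f a" "s \<longlonglongrightarrow> a" "(\<lambda>n. f (s n)) \<longlonglongrightarrow> L"
  shows "f a \<le> L"
proof (rule dense_le)
  fix c assume "c < f a"
  then have "\<forall>\<^sub>F n in sequentially. c < f (s n)"
    using lsc_at_eventually_nhds assms(1,2) unfolding filterlim_iff by blast
  then show "c \<le> L"
    using tendsto_lowerbound[OF assms(3)] by (simp add: eventually_mono less_imp_le)
qed

lemma ACC_pointsI:
  assumes "range s \<subseteq> D" "s \<longlonglongrightarrow> a" "(\<lambda>n. g (s n)) \<longlonglongrightarrow> l"
  shows "l \<in> ACC_points D g a"
proof -
  have "strict_mono (id :: nat \<Rightarrow> nat)" by (simp add: strict_mono_def)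
  moreover have "(g \<circ> s \<circ> id) \<longlonglongrightarrow> l" using assms(3) by (simp add: comp_def)
  ultimately have "l \<in> acc_points (g \<circ> s)" unfolding acc_points_def by blast
  then show ?thesis unfolding ACC_points_def using assms(1,2) by blast
qed

lemma Inf_neighbourhood_le_Inf_ACC:
  fixes f :: "'a::real_normed_vector \<Rightarrow> ereal"
  assumes "a \<in> interior U"
  shows "Inf (f ` U) \<le> Inf (ACC_points UNIV f a)"
proof (rule Inf_greatest)
  fix l assume "l \<in> ACC_points UNIV f a"
  then obtain s r where s: "s \<longlonglongrightarrow> a" "strict_mono (r :: nat \<Rightarrow> nat)" "(f \<circ> s \<circ> r) \<longlonglongrightarrow> l"
    unfolding ACC_points_def acc_points_def by blast
  have "(s \<circ> r) \<longlonglongrightarrow> a" using s LIMSEQ_subseq_LIMSEQ by blast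
  then have "\<forall>\<^sub>F n in sequentially. (s \<circ> r) n \<in> interior U"
    using assms topological_tendstoD by blast
  then have "\<forall>\<^sub>F n in sequentially. Inf (f ` U) \<le> (f \<circ> s \<circ> r) n"
    by eventually_elim (use interior_subset[of U] in \<open>auto intro!: Inf_lower\<close>)
  then show "Inf (f ` U) \<le> l" using tendsto_lowerbound[OF s(3)] by simp
qed

text \<open>The only points of \<open>A\<close> allowed to violate the bound \<open>L \<le> f\<close> in \<open>U\<close> are those of value \<open>-\<infinity>\<close>. If every
  neighbourhood of \<open>a\<close> contains such a point, both infima in the definition are \<open>-\<infinity>\<close>.\<close>

lemma generalized_local_solutionI:
  fixes f :: "'a::real_normed_vector \<Rightarrow> ereal"
  assumes s: "range s \<subseteq> A" "s \<longlonglongrightarrow> a" "(\<lambda>n. f (s n)) \<longlonglongrightarrow> L"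
    and U: "open U" "a \<in> U"
    and ge: "\<And>b. b \<in> A \<Longrightarrow> b \<in> U \<Longrightarrow> f b \<noteq> -\<infinity> \<Longrightarrow> L \<le> f b"
  shows "generalized_local_solution f A a"
proof -
  let ?g = "extreme_barrier f A"
  have cl: "a \<in> closure A" using s(1,2) closure_sequential by blast
  have "\<exists>V. a \<in> interior V \<and> Inf (ACC_points UNIV ?g a) \<le> Inf (?g ` V)"
  proof (cases "\<exists>W. open W \<and> a \<in> W \<and> (\<forall>b\<in>A \<inter> W. f b \<noteq> -\<infinity>)")
    case True
    then obtain W where W: "open W" "a \<in> W" "\<And>b. b \<in> A \<inter> W \<Longrightarrow> f b \<noteq> -\<infinity>" by blast
    have "(\<lambda>n. ?g (s n)) = (\<lambda>n. f (s n))"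
      using s(1) by (auto simp: extreme_barrier_def fun_eq_iff)
    then have "L \<in> ACC_points UNIV ?g a" using s by (intro ACC_pointsI[of s]) auto
    then have "Inf (ACC_points UNIV ?g a) \<le> L" by (rule Inf_lower)
    moreover have "L \<le> Inf (?g ` (U \<inter> W))"
      using ge W(3) by (intro INF_greatest) (simp add: extreme_barrier_def)
    moreover have "a \<in> interior (U \<inter> W)" using U W by (simp add: interior_open)
    ultimately show ?thesis by (meson order_trans)
  next
    case False
    have "a \<in> closure {b \<in> A. f b = -\<infinity>}"
      unfolding closure_iff_nhds_not_empty
      using False by (metis (mono_tags, lifting) IntD1 IntD2 IntI Int_iff empty_iff mem_Collect_eq subsetD)
    then obtain q where q: "\<And>n. q n \<in> {b \<in> A. f b = -\<infinity>}" "q \<longlonglongrightarrow> a"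
      unfolding closure_sequential by blast
    then have "(\<lambda>n. ?g (q n)) = (\<lambda>n. -\<infinity>)" by (auto simp: extreme_barrier_def)
    then have "-\<infinity> \<in> ACC_points UNIV ?g a" using q(2) by (intro ACC_pointsI[of q]) auto
    then have "Inf (ACC_points UNIV ?g a) \<le> -\<infinity>" by (rule Inf_lower)
    then show ?thesis using interior_UNIV by (metis UNIV_I ereal_infty_less_eq(2) ereal_less_eq(2))
  qed
  then show ?thesis
    using cl Inf_neighbourhood_le_Inf_ACC[of a _ ?g] antisym
    unfolding generalized_local_solution_def by metis
qed

lemma locally_finite_pieces_convergent_image:
  fixes g :: "'a::metric_space \<Rightarrow> 'b::complete_space"
  assumes xs: "x \<longlonglongrightarrow> xs" and cover: "range x \<subseteq> (\<Union>i\<in>I. P i)"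
    and U: "xs \<in> interior U" "finite {i \<in> I. P i \<inter> U \<noteq> {}}"
    and uc: "\<And>i. i \<in> I \<Longrightarrow> uniformly_continuous_on (P i) g"
  obtains s l where "strict_mono (s :: nat \<Rightarrow> nat)" "(\<lambda>n. g (x (s n))) \<longlonglongrightarrow> l"
proof -
  \<comment> \<open>finitely many pieces contain the tail of \<open>x\<close>, so one of them contains infinitely many terms\<close>
  obtain m where m: "\<And>n. n \<ge> m \<Longrightarrow> x n \<in> U"
    using topological_tendstoD[OF xs open_interior U(1)] interior_subset[of U]
    unfolding eventually_sequentially by blast
  have "\<forall>n\<in>{m..}. \<exists>i\<in>{i \<in> I. P i \<inter> U \<noteq> {}}. x n \<in> P i" using m cover by fastforce
  then obtain i where i: "i \<in> I" "infinite {n \<in> {m..}. x n \<in> P i}"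
    using pigeonhole_infinite_rel[OF infinite_Ici U(2), where R = "\<lambda>n i. x n \<in> P i"] by blast
  define s where "s = enumerate {n \<in> {m..}. x n \<in> P i}"
  have s: "strict_mono s" unfolding s_def using i(2) by (rule strict_mono_enumerate)
  have sP: "x (s n) \<in> P i" for n using enumerate_in_set[OF i(2), of n] by (simp add: s_def)
  have "(\<lambda>n. x (s n)) \<longlonglongrightarrow> xs" using LIMSEQ_subseq_LIMSEQ[OF xs s] by (simp add: comp_def)
  then have "Cauchy (\<lambda>n. g (x (s n)))"
    using uniformly_continuous_on_Cauchy[OF uc[OF i(1)]] LIMSEQ_imp_Cauchy sP by blast
  then show thesis using that s Cauchy_convergent convergent_def by blast
qed

section \<open>Partitioned optimization\<close>

lemma index_fun_eq:
  assumes "disjoint_family blk" "y \<in> blk z"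
  shows "index_fun blk y = z"
  unfolding index_fun_def using assms by (auto simp: disjoint_family_on_def intro!: the_equality)

theorem theorem2:
  fixes \<phi> :: "'y::banach \<Rightarrow> ereal"
    and \<Omega> :: "'y set"
    and blk :: "'x::real_normed_vector \<Rightarrow> 'y set"
    and \<gamma> :: "'x \<Rightarrow> 'y"
    and N :: enat
    and Xi :: "nat \<Rightarrow> 'x set"
    and x :: "nat \<Rightarrow> 'x"
  assumes finite_dim: "\<exists>B :: 'x set. finite B \<and> span B = UNIV"
    and feasible: "effective_domain \<phi> \<inter> \<Omega> \<noteq> {}"
    and part_disjoint: "disjoint_family blk"
    and part_cover: "(\<Union>z. blk z) = UNIV"
    and subproblems: "\<And>z. z \<in> effective_indices \<phi> \<Omega> blk \<Longrightarrow>
           global_solutions \<phi> (blk z \<inter> \<Omega>) \<noteq> {}"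
    and gamma_oracle: "oracle_fun \<phi> \<Omega> blk \<gamma>"
    and index_cont: "continuous_on UNIV (index_fun blk)"
    and N_pos: "1 \<le> N"
    and Xi_disjoint: "disjoint_family_on Xi {i. 1 \<le> i \<and> enat i \<le> N}"
    and Xi_cover: "(\<Union>i \<in> {i. 1 \<le> i \<and> enat i \<le> N}. Xi i) = effective_indices \<phi> \<Omega> blk"
    and Xi_locally_finite: "\<And>z. z \<in> closure (effective_indices \<phi> \<Omega> blk) \<Longrightarrow>
           \<exists>U. z \<in> interior U \<and> finite {i. 1 \<le> i \<and> enat i \<le> N \<and> Xi i \<inter> U \<noteq> {}}"
    and oracle_unif_cont: "\<And>i. 1 \<le> i \<Longrightarrow> enat i \<le> N \<Longrightarrow> uniformly_continuous_on (Xi i) \<gamma>"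
    and index_bounded: "\<And>S :: 'y set. bounded S \<Longrightarrow> bounded (index_fun blk ` S)"
    and bounded_below: "\<exists>m :: real. \<forall>y \<in> \<gamma> ` effective_indices \<phi> \<Omega> blk. ereal m \<le> \<phi> y"
    and bounded_sublevels: "\<And>c :: real.
           bounded {y \<in> \<gamma> ` effective_indices \<phi> \<Omega> blk. \<phi> y \<le> ereal c}"
    and Xi_ample: "\<And>i. 1 \<le> i \<Longrightarrow> enat i \<le> N \<Longrightarrow> ample (Xi i)"
    and objective_cont: "\<And>i. 1 \<le> i \<Longrightarrow> enat i \<le> N \<Longrightarrow> continuous_on (\<gamma> ` Xi i) \<phi>"
    and generated: "covering_algorithm_sequence (reformulated_objective \<phi> \<Omega> blk \<gamma>)
           (effective_indices \<phi> \<Omega> blk) x"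
  shows "acc_points x \<noteq> {} \<and>
    (\<forall>xs \<in> acc_points x. \<exists>ys \<in> ACC_points (effective_indices \<phi> \<Omega> blk) \<gamma> xs.
        generalized_local_solution \<phi> \<Omega> ys) \<and>
    (\<forall>xs \<in> acc_points x.
        xs \<in> effective_indices \<phi> \<Omega> blk \<longrightarrow>
        (\<forall>y \<in> ACC_points (effective_indices \<phi> \<Omega> blk) \<gamma> xs. lsc_at \<phi> y) \<longrightarrow>
        ACC_points (effective_indices \<phi> \<Omega> blk) \<gamma> xs \<subseteq> \<Omega> \<longrightarrow>
        local_solution \<phi> \<Omega> (\<gamma> xs))"
proof -
  let ?X = "effective_indices \<phi> \<Omega> blk"
  let ?\<Phi> = "reformulated_objective \<phi> \<Omega> blk \<gamma>"
  let ?\<chi> = "index_fun blk"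
  let ?I = "{i. 1 \<le> i \<and> enat i \<le> N}"
  have \<Phi>_eq: "?\<Phi> z = \<phi> (\<gamma> z)" if "z \<in> ?X" for z
    using that by (simp add: reformulated_objective_def)
  have \<gamma>_opt: "\<gamma> z \<in> blk z" "\<gamma> z \<in> \<Omega>" "\<bar>\<phi> (\<gamma> z)\<bar> \<noteq> \<infinity>"
      "\<And>y. y \<in> blk z \<Longrightarrow> y \<in> \<Omega> \<Longrightarrow> \<phi> (\<gamma> z) \<le> \<phi> y" if "z \<in> ?X" for z
    using gamma_oracle that
    unfolding oracle_fun_def global_solutions_def is_arg_min_linorder effective_domain_def
    by (blast, blast, auto)
  have \<chi>_eq: "?\<chi> y = z" if "y \<in> blk z" for y z
    using index_fun_eq[OF part_disjoint that] .
  have in_blk: "y \<in> blk (?\<chi> y)" for y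
    using part_cover \<chi>_eq by blast
  have \<chi>_lim: "(\<lambda>n. ?\<chi> (u n)) \<longlonglongrightarrow> ?\<chi> l" if "u \<longlonglongrightarrow> l" for u l
    using continuous_on_tendsto_compose[OF index_cont that] by simp
  obtain H where H: "H 0 = {x 0}"
      "\<And>k. covering_step ?\<Phi> (x k) (H k) (x (Suc k)) (H (Suc k))" and x0: "x 0 \<in> ?X"
    using generated unfolding covering_algorithm_sequence_def by blast
  have dec: "decseq (\<lambda>k. ?\<Phi> (x k))" using H(2) by (rule covering_values_decseq)
  have le0: "?\<Phi> (x k) \<le> \<phi> (\<gamma> (x 0))" for k
    using decseqD[OF dec, of 0 k] \<Phi>_eq[OF x0] by simp
  have xX: "x k \<in> ?X" for k
  proof (rule ccontr)
    assume "x k \<notin> ?X"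
    then have "?\<Phi> (x k) = \<infinity>" by (simp add: reformulated_objective_def)
    then show False using le0[of k] \<gamma>_opt(3)[OF x0] by auto
  qed
  have \<chi>\<gamma>: "?\<chi> (\<gamma> z) = z" if "z \<in> ?X" for z
    using \<chi>_eq \<gamma>_opt(1)[OF that] by blast
  define L where "L = (INF k. ?\<Phi> (x k))"
  have lim: "(\<lambda>k. ?\<Phi> (x k)) \<longlonglongrightarrow> L" unfolding L_def using LIMSEQ_INF[OF dec] .
  have L_le: "L \<le> ?\<Phi> h" if h: "h \<in> (\<Union>k. H k)" for h
  proof -
    obtain k where "h \<in> H k" using h by blast
    then have "?\<Phi> (x k) \<le> ?\<Phi> h" by (rule covering_history_ge[of H x, OF H])
    then show ?thesis unfolding L_def by (meson INF_lower UNIV_I order_trans)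
  qed

  have acc_ne: "acc_points x \<noteq> {}"
  proof -
    obtain c where c: "\<phi> (\<gamma> (x 0)) = ereal c" using \<gamma>_opt(3)[OF x0] by auto
    have "bounded (?\<chi> ` {y \<in> \<gamma> ` ?X. \<phi> y \<le> ereal c})"
      using index_bounded[OF bounded_sublevels] .
    moreover have "x k \<in> ?\<chi> ` {y \<in> \<gamma> ` ?X. \<phi> y \<le> ereal c}" for k
      using \<chi>\<gamma>[OF xX[of k]] le0[of k] \<Phi>_eq[OF xX[of k]] c xX[of k]
      by (intro image_eqI[of _ _ "\<gamma> (x k)"]) auto
    ultimately have "bounded (range x)" by (blast intro: bounded_subset)
    then show ?thesis
      using bounded_seq_convergent_subseq_finite_span[OF finite_dim]
      unfolding acc_points_def by blast
  qed

  \<comment> \<open>a block outside the effective indices contains feasible points of infinite value only, and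
     those of value \<open>-\<infinity>\<close> have to be excluded by hypothesis\<close>
  have near: "L \<le> \<phi> y"
    if xs: "xs \<in> acc_points x" and y: "y \<in> \<Omega>" "?\<chi> y \<in> ball xs 1" "\<phi> y \<noteq> -\<infinity>" for xs y
  proof (cases "?\<chi> y \<in> ?X")
    case True
    then obtain i where i: "1 \<le> i" "enat i \<le> N" "?\<chi> y \<in> Xi i" using Xi_cover by blast
    have dense: "ball xs 1 \<subseteq> closure (\<Union>k. H k)"
      using finite_dim H(2) xs by (rule trial_points_dense_near_acc_point)
    have sub: "Xi i \<subseteq> ?X" using i Xi_cover by blast
    have "continuous_on (Xi i) (\<lambda>z. \<phi> (\<gamma> z))"
      using continuous_on_compose2[OF objective_cont[OF i(1,2)]
          uniformly_continuous_imp_continuous[OF oracle_unif_cont[OF i(1,2)]]] by blast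
    then have "continuous_on (Xi i) ?\<Phi>"
      using sub \<Phi>_eq by (subst continuous_on_cong[OF refl, of _ _ "\<lambda>z. \<phi> (\<gamma> z)"]) auto
    then have "L \<le> ?\<Phi> (?\<chi> y)"
      using Xi_ample[OF i(1,2)] ample_continuous_ge_from_dense[OF _ _ open_ball dense _ i(3) y(2)]
        L_le by blast
    then show ?thesis
      using \<Phi>_eq[OF True] \<gamma>_opt(4)[OF True in_blk y(1)] by simp
  next
    case False
    then have "\<phi> y = \<infinity>"
      using in_blk y unfolding effective_indices_def effective_domain_def by blast
    then show ?thesis by simp
  qed

  have limit: "\<exists>ys u. range u \<subseteq> ?X \<and> u \<longlonglongrightarrow> xs \<and> (\<lambda>n. \<gamma> (u n)) \<longlonglongrightarrow> ys \<and>
      (\<lambda>n. \<phi> (\<gamma> (u n))) \<longlonglongrightarrow> L \<and> ?\<chi> ys = xs"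
    if xs: "xs \<in> acc_points x" for xs
  proof -
    obtain r where r: "strict_mono (r :: nat \<Rightarrow> nat)" "(x \<circ> r) \<longlonglongrightarrow> xs"
      using xs unfolding acc_points_def by blast
    have "xs \<in> closure ?X" using r(2) xX unfolding closure_sequential by (metis comp_apply)
    then obtain U where U: "xs \<in> interior U" "finite {i. 1 \<le> i \<and> enat i \<le> N \<and> Xi i \<inter> U \<noteq> {}}"
      using Xi_locally_finite by blast
    have fin: "finite {i \<in> ?I. Xi i \<inter> U \<noteq> {}}" using U(2) by (simp add: conj_assoc)
    have cov: "range (x \<circ> r) \<subseteq> (\<Union>i\<in>?I. Xi i)" using xX Xi_cover by auto
    obtain s ys where s: "strict_mono (s :: nat \<Rightarrow> nat)" "(\<lambda>n. \<gamma> ((x \<circ> r) (s n))) \<longlonglongrightarrow> ys"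
      using locally_finite_pieces_convergent_image[OF r(2) cov U(1) fin] oracle_unif_cont by blast
    define u where "u = x \<circ> r \<circ> s"
    have ux: "u \<longlonglongrightarrow> xs"
      using LIMSEQ_subseq_LIMSEQ[OF r(2) s(1)] by (simp add: u_def)
    have uy: "(\<lambda>n. \<gamma> (u n)) \<longlonglongrightarrow> ys" using s(2) by (simp add: u_def)
    have "(\<lambda>n. ?\<Phi> (u n)) \<longlonglongrightarrow> L"
      using LIMSEQ_subseq_LIMSEQ[OF lim strict_mono_o[OF r(1) s(1)]] by (simp add: comp_def u_def)
    then have uL: "(\<lambda>n. \<phi> (\<gamma> (u n))) \<longlonglongrightarrow> L" using \<Phi>_eq xX by (simp add: u_def)
    have "u \<longlonglongrightarrow> ?\<chi> ys" using \<chi>_lim[OF uy] \<chi>\<gamma> xX by (simp add: u_def comp_def)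
    then have "?\<chi> ys = xs" using ux LIMSEQ_unique by blast
    moreover have "range u \<subseteq> ?X" using xX by (auto simp: u_def)
    ultimately show ?thesis using ux uy uL by blast
  qed

  have open_nbhd: "open (?\<chi> -` ball xs 1)" for xs
    using open_vimage[OF open_ball index_cont] .

  have "\<exists>ys\<in>ACC_points ?X \<gamma> xs. generalized_local_solution \<phi> \<Omega> ys"
    if xs: "xs \<in> acc_points x" for xs
  proof -
    obtain ys u where u: "range u \<subseteq> ?X" "u \<longlonglongrightarrow> xs" "(\<lambda>n. \<gamma> (u n)) \<longlonglongrightarrow> ys"
        "(\<lambda>n. \<phi> (\<gamma> (u n))) \<longlonglongrightarrow> L" "?\<chi> ys = xs"
      using limit[OF xs] by blast
    have "range (\<lambda>n. \<gamma> (u n)) \<subseteq> \<Omega>" using u(1) \<gamma>_opt(2) by blast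
    then have "generalized_local_solution \<phi> \<Omega> ys"
      using near[OF xs] u(5) by (intro generalized_local_solutionI[OF _ u(3,4) open_nbhd[of xs]]) auto
    then show ?thesis using ACC_pointsI[OF u(1,2,3)] by blast
  qed
  moreover have "local_solution \<phi> \<Omega> (\<gamma> xs)"
    if xs: "xs \<in> acc_points x" "xs \<in> ?X" and lsc: "\<forall>y\<in>ACC_points ?X \<gamma> xs. lsc_at \<phi> y"
      and feas: "ACC_points ?X \<gamma> xs \<subseteq> \<Omega>" for xs
  proof -
    obtain ys u where u: "range u \<subseteq> ?X" "u \<longlonglongrightarrow> xs" "(\<lambda>n. \<gamma> (u n)) \<longlonglongrightarrow> ys"
        "(\<lambda>n. \<phi> (\<gamma> (u n))) \<longlonglongrightarrow> L" "?\<chi> ys = xs"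
      using limit[OF xs(1)] by blast
    have ys: "ys \<in> ACC_points ?X \<gamma> xs" using ACC_pointsI[OF u(1,2,3)] .
    have "\<phi> (\<gamma> xs) \<le> \<phi> ys" using \<gamma>_opt(4)[OF xs(2)] ys feas in_blk[of ys] u(5) by blast
    also have "\<phi> ys \<le> L" using lsc_at_le_seq_limit[OF _ u(3,4)] lsc ys by blast
    finally have le: "\<phi> (\<gamma> xs) \<le> L" .
    have "\<gamma> xs \<in> ACC_points ?X \<gamma> xs"
      by (rule ACC_pointsI[of "\<lambda>n. xs"]) (use xs(2) in auto)
    then have "lsc_at \<phi> (\<gamma> xs)" using lsc by blast
    moreover have "-\<infinity> < \<phi> (\<gamma> xs)" using \<gamma>_opt(3)[OF xs(2)] by auto
    ultimately have "\<forall>\<^sub>F y in nhds (\<gamma> xs). -\<infinity> < \<phi> y" by (rule lsc_at_eventually_nhds)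
    then obtain W where W: "open W" "\<gamma> xs \<in> W" "\<And>y. y \<in> W \<Longrightarrow> -\<infinity> < \<phi> y"
      unfolding eventually_nhds by blast
    define V where "V = W \<inter> ?\<chi> -` ball xs 1"
    have "\<gamma> xs \<in> interior V"
      using W(1,2) open_nbhd[of xs] \<chi>\<gamma>[OF xs(2)] by (simp add: V_def interior_open open_Int)
    moreover have "\<phi> (\<gamma> xs) \<le> \<phi> b" if "b \<in> \<Omega> \<inter> V" for b
      using near[OF xs(1), of b] that W(3)[of b] le by (auto simp: V_def)
    ultimately show ?thesis unfolding local_solution_def using \<gamma>_opt(2)[OF xs(2)] by blast
  qed
  ultimately show ?thesis using acc_ne by blast
qed

end
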